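(* Let $G$ be a finite group and $V$ a finite-dimensional representation of $G$ over a field $\mathbf{k}$ whose only roots of unity are $\pm1$. Then $$\beta^{\mathbf{r}}_{\mathrm{field}}(G,V)=\beta_{\mathrm{field}}(G,V).$$
   Context: $\mathbf{k}[V]$ is the polynomial ring of $V$ (the symmetric algebra of $V^*$, with its induced $G$-action), $\mathbf{k}(V)$ is its fraction field, and $\mathbf{k}(V)^G$ is the field of invariant rational functions. For $f\in\mathbf{k}(V)$ written as $f=f_1/f_2$ with $f_1,f_2\in\mathbf{k}[V]$ and $\gcd(f_1,f_2)=1$, the degree of $f$ is $\deg f:=\deg f_1+\deg f_2$ (constants, including $0$, have degree $0$). $\mathbf{k}(V)^G_{\leq d}$ is the set of invariant rational functions of degree $\leq d$. With minima over positive integers $d$ and fields generated over $\mathbf{k}$, define $$\beta_{\mathrm{field}}(G,V):=\min\{d:\mathbf{k}(V)^G\text{ is generated as a field by invariant polynomials of degree}\leq d\},$$ $$\beta^{\mathbf{r}}_{\mathrm{field}}(G,V):=\min\{d:\mathbf{k}(V)^G\text{ is generated as a field by }\mathbf{k}(V)^G_{\leq d}\}.$$ *)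

theory Defs
  imports
    Complex_Main
    "HOL-Library.Poly_Mapping"
    "HOL-Computational_Algebra.Fraction_Field"
    "HOL-Algebra.Group_Action"
begin

text \<open>
  Polynomials in the variables \<open>x\<^sub>0, x\<^sub>1, \<dots>\<close> over \<open>'k\<close>: a monomial is a finitely supported
  exponent function, a polynomial is a finitely supported function from monomials to \<open>'k\<close>, with the
  convolution product. If \<open>bs\<close> is an ordered basis of \<open>V\<close>, the variable \<open>x\<^sub>i\<close> stands for
  the \<open>i\<close>-th element of the dual basis of \<open>V\<^sup>*\<close>, so that the symmetric algebra of \<open>V\<^sup>*\<close> is
  the ring of polynomials in the variables \<open>x\<^sub>i\<close> with \<open>i < length bs\<close>.
\<close>

type_synonym 'k mpol = "(nat \<Rightarrow>\<^sub>0 nat) \<Rightarrow>\<^sub>0 'k"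

definition const_pol :: "'k::field \<Rightarrow> 'k mpol"
  where "const_pol c = Poly_Mapping.single 0 c"

definition mon_degree :: "(nat \<Rightarrow>\<^sub>0 nat) \<Rightarrow> nat"
  where "mon_degree m = (\<Sum>i\<in>Poly_Mapping.keys m. Poly_Mapping.lookup m i)"

text \<open>Total degree; the zero polynomial gets degree 0.\<close>

definition tot_degree :: "'k::field mpol \<Rightarrow> nat"
  where "tot_degree p = Max (insert 0 (mon_degree ` Poly_Mapping.keys p))"

definition pol_ring :: "nat \<Rightarrow> 'k::field mpol set"
  where "pol_ring n = {p. \<forall>m\<in>Poly_Mapping.keys p. Poly_Mapping.keys m \<subseteq> {..<n}}"

definition rat_field :: "nat \<Rightarrow> 'k::field mpol fract set"
  where "rat_field n = {Fract p q | p q. p \<in> pol_ring n \<and> q \<in> pol_ring n \<and> q \<noteq> 0}"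

definition pol_to_rat :: "'k::field mpol \<Rightarrow> 'k mpol fract"
  where "pol_to_rat p = Fract p 1"

text \<open>
  The gcd of two polynomials is 1 (up to units). Divisors may range over the ring in all
  variables: a divisor of a nonzero element of \<open>pol_ring n\<close> lies in \<open>pol_ring n\<close>.
\<close>

definition coprime_pol :: "'k::field mpol \<Rightarrow> 'k mpol \<Rightarrow> bool"
  where "coprime_pol p q \<longleftrightarrow> (\<forall>h. h dvd p \<longrightarrow> h dvd q \<longrightarrow> h dvd 1)"

text \<open>Well defined since numerator and denominator in lowest terms are unique up to scalars.\<close>

definition rat_degree :: "nat \<Rightarrow> 'k::field mpol fract \<Rightarrow> nat"
  where "rat_degree n f = (THE d. \<exists>p\<in>pol_ring n. \<exists>q\<in>pol_ring n.
           q \<noteq> 0 \<and> f = Fract p q \<and> coprime_pol p q \<and> d = tot_degree p + tot_degree q)"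

text \<open>
  \<open>pullback_form scale bs T i\<close> is the linear form \<open>x\<^sub>i \<circ> T\<close>, written in the variables: the
  coefficient of \<open>x\<^sub>j\<close> is the \<open>i\<close>-th coordinate of \<open>T (bs ! j)\<close>. \<open>pullback_pol\<close> is the induced
  \<open>'k\<close>-algebra homomorphism, i.e. the substitution of \<open>x\<^sub>i \<circ> T\<close> for \<open>x\<^sub>i\<close>.
\<close>

definition pullback_form ::
    "('k::field \<Rightarrow> 'v::ab_group_add \<Rightarrow> 'v) \<Rightarrow> 'v list \<Rightarrow> ('v \<Rightarrow> 'v) \<Rightarrow> nat \<Rightarrow> 'k mpol"
  where "pullback_form scale bs T i =
    (\<Sum>j<length bs. Poly_Mapping.single (Poly_Mapping.single j 1)
        (Modules.module.representation scale (set bs) (T (bs ! j)) (bs ! i)))"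

definition pullback_pol ::
    "('k::field \<Rightarrow> 'v::ab_group_add \<Rightarrow> 'v) \<Rightarrow> 'v list \<Rightarrow> ('v \<Rightarrow> 'v) \<Rightarrow> 'k mpol \<Rightarrow> 'k mpol"
  where "pullback_pol scale bs T p =
    (\<Sum>m\<in>Poly_Mapping.keys p. const_pol (Poly_Mapping.lookup p m) *
       (\<Prod>i\<in>Poly_Mapping.keys m. pullback_form scale bs T i ^ Poly_Mapping.lookup m i))"

text \<open>The induced action on polynomials: \<open>(g \<cdot> p)(v) = p (g\<^sup>-\<^sup>1 v)\<close>.\<close>

definition pol_action ::
    "('g, 'm) monoid_scheme \<Rightarrow> ('g \<Rightarrow> 'v \<Rightarrow> 'v) \<Rightarrow> ('k::field \<Rightarrow> 'v::ab_group_add \<Rightarrow> 'v) \<Rightarrow>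
      'v list \<Rightarrow> 'g \<Rightarrow> 'k mpol \<Rightarrow> 'k mpol"
  where "pol_action G \<rho> scale bs g p = pullback_pol scale bs (\<rho> (inv\<^bsub>G\<^esub> g)) p"

definition inv_pols ::
    "('g, 'm) monoid_scheme \<Rightarrow> ('g \<Rightarrow> 'v \<Rightarrow> 'v) \<Rightarrow> ('k::field \<Rightarrow> 'v::ab_group_add \<Rightarrow> 'v) \<Rightarrow>
      'v list \<Rightarrow> 'k mpol set"
  where "inv_pols G \<rho> scale bs =
    {p \<in> pol_ring (length bs). \<forall>g\<in>carrier G. pol_action G \<rho> scale bs g p = p}"

text \<open>
  The induced action on rational functions is \<open>g \<cdot> (p / q) = (g \<cdot> p) / (g \<cdot> q)\<close>; the result does
  not depend on the chosen fraction since each \<open>g\<close> acts by an automorphism of the polynomial ring.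
\<close>

definition rat_action ::
    "('g, 'm) monoid_scheme \<Rightarrow> ('g \<Rightarrow> 'v \<Rightarrow> 'v) \<Rightarrow> ('k::field \<Rightarrow> 'v::ab_group_add \<Rightarrow> 'v) \<Rightarrow>
      'v list \<Rightarrow> 'g \<Rightarrow> 'k mpol fract \<Rightarrow> 'k mpol fract"
  where "rat_action G \<rho> scale bs g f =
    (THE h. \<exists>p\<in>pol_ring (length bs). \<exists>q\<in>pol_ring (length bs). q \<noteq> 0 \<and> f = Fract p q \<and>
       h = Fract (pol_action G \<rho> scale bs g p) (pol_action G \<rho> scale bs g q))"

definition inv_rats ::
    "('g, 'm) monoid_scheme \<Rightarrow> ('g \<Rightarrow> 'v \<Rightarrow> 'v) \<Rightarrow> ('k::field \<Rightarrow> 'v::ab_group_add \<Rightarrow> 'v) \<Rightarrow>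
      'v list \<Rightarrow> 'k mpol fract set"
  where "inv_rats G \<rho> scale bs =
    {f \<in> rat_field (length bs). \<forall>g\<in>carrier G. rat_action G \<rho> scale bs g f = f}"

definition is_subfield :: "'a::field set \<Rightarrow> bool"
  where "is_subfield K \<longleftrightarrow> 0 \<in> K \<and> 1 \<in> K \<and>
    (\<forall>x\<in>K. \<forall>y\<in>K. x + y \<in> K \<and> x * y \<in> K) \<and> (\<forall>x\<in>K. - x \<in> K \<and> inverse x \<in> K)"

text \<open>The subfield generated by \<open>S\<close> over the ground field \<open>'k\<close>.\<close>

definition field_gen :: "'k::field mpol fract set \<Rightarrow> 'k mpol fract set"
  where "field_gen S = is_subfield hull (range (\<lambda>c. pol_to_rat (const_pol c)) \<union> S)"

definition beta_field ::
    "('g, 'm) monoid_scheme \<Rightarrow> ('g \<Rightarrow> 'v \<Rightarrow> 'v) \<Rightarrow> ('k::field \<Rightarrow> 'v::ab_group_add \<Rightarrow> 'v) \<Rightarrow>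
      'v list \<Rightarrow> nat"
  where "beta_field G \<rho> scale bs = (LEAST d. 0 < d \<and>
    field_gen (pol_to_rat ` {p \<in> inv_pols G \<rho> scale bs. tot_degree p \<le> d}) =
      inv_rats G \<rho> scale bs)"

definition beta_field_rat ::
    "('g, 'm) monoid_scheme \<Rightarrow> ('g \<Rightarrow> 'v \<Rightarrow> 'v) \<Rightarrow> ('k::field \<Rightarrow> 'v::ab_group_add \<Rightarrow> 'v) \<Rightarrow>
      'v list \<Rightarrow> nat"
  where "beta_field_rat G \<rho> scale bs = (LEAST d. 0 < d \<and>
    field_gen {f \<in> inv_rats G \<rho> scale bs. rat_degree (length bs) f \<le> d} =
      inv_rats G \<rho> scale bs)"

text \<open>
  The finite-dimensional representations of \<open>G\<close> on the \<open>'k\<close>-vector space \<open>'v\<close>, together with an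
  ordered basis \<open>bs\<close> of it. \<open>group_action\<close> includes that \<open>G\<close> is a group.
\<close>

locale fd_representation =
  group_action G "UNIV :: 'v set" \<rho> + finite_dimensional_vector_space scale "set bs"
  for G :: "('g, 'm) monoid_scheme"
    and \<rho> :: "'g \<Rightarrow> 'v::ab_group_add \<Rightarrow> 'v"
    and scale :: "'k::field \<Rightarrow> 'v \<Rightarrow> 'v"
    and bs :: "'v list" +
  assumes linear_action: "g \<in> carrier G \<Longrightarrow> Vector_Spaces.linear scale scale (\<rho> g)"
    and distinct_basis: "distinct bs"

end

theory Submission
  imports Defs "HOL-Computational_Algebra.Polynomial"
begin

text \<open>
  For every bound \<open>d\<close>, the invariant polynomials of degree at most \<open>d\<close> and the invariant rational functions
  of degree at most \<open>d\<close> generate the same field, so both minima are taken over the same bounds.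

  A polynomial is a rational function of the same degree, so only one inclusion needs an idea. Let
  \<open>f = p / q\<close> be invariant and in lowest terms. For a group element \<open>g\<close>, the fraction
  \<open>(g \<cdot> p) / (g \<cdot> q)\<close> also represents \<open>f\<close>. Unique factorization and the fact that \<open>g\<close> acts by linear
  substitutions give a constant \<open>c\<close> with \<open>g \<cdot> p = c p\<close> and \<open>g \<cdot> q = c q\<close>
  (\<open>invariant_fraction_semi_invariant\<close>). As the group is finite, \<open>c\<close> is a root of unity, so \<open>c = 1\<close> or
  \<open>c = -1\<close>. Hence \<open>p\<^sup>2\<close>, \<open>p q\<close> and \<open>q\<^sup>2\<close> are invariant, and a nonzero \<open>f\<close> is both \<open>p\<^sup>2 / (p q)\<close> and
  \<open>p q / q\<^sup>2\<close>. One of \<open>p\<^sup>2\<close> and \<open>q\<^sup>2\<close> has degree at most \<open>deg p + deg q = deg (p q)\<close>, so one of the two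
  expressions has both numerator and denominator of degree at most \<open>deg f\<close>
  (\<open>invariant_fraction_in_field_gen\<close>).

  Unique factorization is also what makes the degree of a rational function well defined. It is proved
  by induction on the number of variables in the form that irreducible polynomials are prime
  (\<open>irreducibles_prime_pol_ring\<close>). The induction step is Gauss's lemma, phrased with divisibility
  in the polynomial ring itself: a coefficient that would become a unit in the fraction field of the
  coefficient ring is carried along and cancelled at the end (\<open>dvd_cancel_coefficient\<close>). From it follows
  Euclid's lemma for coprime polynomials (\<open>coprime_pol_dvd_mult\<close>).
\<close>

section \<open>Polynomials as sums of monomials\<close>

text \<open>
  Applied to a polynomial, this is its expansion into terms; applied to an exponent function \<open>m\<close>, it
  lets the monomial with exponents \<open>m\<close> be written as a product of powers of variables.
\<close>

lemma sum_single_lookup: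
  "(\<Sum>k\<in>Poly_Mapping.keys p. Poly_Mapping.single k (Poly_Mapping.lookup p k)) = p"
proof (rule poly_mapping_eqI)
  fix k
  have "Poly_Mapping.lookup (\<Sum>k\<in>Poly_Mapping.keys p. Poly_Mapping.single k (Poly_Mapping.lookup p k)) k
    = (\<Sum>j\<in>Poly_Mapping.keys p. if k = j then Poly_Mapping.lookup p j else 0)"
    by (auto simp: lookup_sum lookup_single when_def intro!: sum.cong)
  also have "\<dots> = Poly_Mapping.lookup p k"
    by (simp add: in_keys_iff)
  finally show "Poly_Mapping.lookup (\<Sum>k\<in>Poly_Mapping.keys p. Poly_Mapping.single k (Poly_Mapping.lookup p k)) k
    = Poly_Mapping.lookup p k" .
qed

definition var :: "nat \<Rightarrow> 'k::field mpol"
  where "var i = Poly_Mapping.single (Poly_Mapping.single i 1) 1"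

lemma const_pol_0 [simp]: "const_pol 0 = 0"
  and const_pol_1 [simp]: "const_pol 1 = 1"
  and const_pol_add: "const_pol (a + b) = const_pol a + const_pol b"
  and const_pol_mult: "const_pol (a * b) = const_pol a * const_pol b"
  by (simp_all add: const_pol_def single_add mult_single)

lemma const_pol_sum: "const_pol (\<Sum>i\<in>I. f i) = (\<Sum>i\<in>I. const_pol (f i))"
  by (induction I rule: infinite_finite_induct) (simp_all add: const_pol_add)

lemma const_pol_eq_iff [simp]: "const_pol a = const_pol b \<longleftrightarrow> a = b"
  by (metis const_pol_def lookup_single_eq)

lemma var_power: "var i ^ k = Poly_Mapping.single (Poly_Mapping.single i k) 1"
  by (induction k) (simp_all add: var_def mult_single flip: single_add)

lemma prod_single_one:
  "(\<Prod>i\<in>I. Poly_Mapping.single (f i) 1) = (Poly_Mapping.single (sum f I) 1 :: 'k::field mpol)"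
  by (induction I rule: infinite_finite_induct) (simp_all add: mult_single)

lemma single_eq_const_times_vars:
  "Poly_Mapping.single m c = const_pol c * (\<Prod>i\<in>Poly_Mapping.keys m. var i ^ Poly_Mapping.lookup m i)"
  by (simp add: var_power prod_single_one sum_single_lookup const_pol_def mult_single)

lemma const_pol_in_pol_ring [simp, intro]: "const_pol c \<in> pol_ring n"
  by (auto simp: pol_ring_def const_pol_def split: if_splits)

lemma zero_in_pol_ring [simp, intro]: "0 \<in> pol_ring n"
  and one_in_pol_ring [simp, intro]: "1 \<in> pol_ring n"
  by (auto simp: pol_ring_def)

lemma var_in_pol_ring [intro]: "i < n \<Longrightarrow> var i \<in> pol_ring n"
  by (auto simp: pol_ring_def var_def split: if_splits)

lemma add_in_pol_ring [intro]: "p \<in> pol_ring n \<Longrightarrow> q \<in> pol_ring n \<Longrightarrow> p + q \<in> pol_ring n"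
  using keys_add[of p q] by (fastforce simp: pol_ring_def)

lemma mult_in_pol_ring [intro]:
  assumes "p \<in> pol_ring n" "q \<in> pol_ring n"
  shows "p * q \<in> pol_ring n"
proof -
  have "Poly_Mapping.keys m \<subseteq> {..<n}" if m: "m \<in> Poly_Mapping.keys (p * q)" for m
  proof -
    obtain a b where "m = a + b" "a \<in> Poly_Mapping.keys p" "b \<in> Poly_Mapping.keys q"
      using m keys_mult[of p q] by blast
    then show ?thesis
      using assms keys_add[of a b] by (fastforce simp: pol_ring_def)
  qed
  then show ?thesis by (simp add: pol_ring_def)
qed

lemma uminus_in_pol_ring [intro]: "p \<in> pol_ring n \<Longrightarrow> - p \<in> pol_ring n"
  by (auto simp: pol_ring_def in_keys_iff)

lemma diff_in_pol_ring [intro]: "p \<in> pol_ring n \<Longrightarrow> q \<in> pol_ring n \<Longrightarrow> p - q \<in> pol_ring n"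
  using add_in_pol_ring[of p n "- q"] by auto

lemma power_in_pol_ring [intro]: "p \<in> pol_ring n \<Longrightarrow> p ^ k \<in> pol_ring n"
  by (induction k) auto

lemma sum_in_pol_ring [intro]: "(\<And>i. i \<in> I \<Longrightarrow> f i \<in> pol_ring n) \<Longrightarrow> sum f I \<in> pol_ring n"
  by (induction I rule: infinite_finite_induct) auto

lemma pol_ring_mono: "n \<le> n' \<Longrightarrow> pol_ring n \<subseteq> pol_ring n'"
  by (fastforce simp: pol_ring_def)

lemma in_some_pol_ring: "\<exists>n. p \<in> pol_ring n"
proof -
  have "finite (\<Union>m\<in>Poly_Mapping.keys p. Poly_Mapping.keys m)" by simp
  then obtain n where "(\<Union>m\<in>Poly_Mapping.keys p. Poly_Mapping.keys m) \<subseteq> {..<n}"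
    using finite_nat_iff_bounded by blast
  then show ?thesis by (auto simp: pol_ring_def)
qed

text \<open>
  The constants and the variables generate \<open>pol_ring n\<close> as a ring, so ring homomorphisms out of it
  may be compared on generators. All identities between substitutions below are obtained this way.
\<close>

lemma pol_ring_induct [consumes 1, case_names const var add mult]:
  assumes p: "p \<in> pol_ring n"
    and const: "\<And>c. P (const_pol c)"
    and var: "\<And>i. i < n \<Longrightarrow> P (var i)"
    and add: "\<And>p q. P p \<Longrightarrow> P q \<Longrightarrow> P (p + q)"
    and mult: "\<And>p q. P p \<Longrightarrow> P q \<Longrightarrow> P (p * q)"
  shows "P p"
proof -
  have one: "P 1" using const[of 1] by simp
  have zero: "P 0" using const[of 0] by simp
  have power: "P (q ^ k)" if "P q" for q k
    by (induction k) (simp_all add: one mult that)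
  have prod: "P (prod f I)" if "\<And>i. i \<in> I \<Longrightarrow> P (f i)" for f and I :: "nat set"
    using that by (induction I rule: infinite_finite_induct) (simp_all add: one mult)
  have sum: "P (sum f I)" if "\<And>i. i \<in> I \<Longrightarrow> P (f i)" for f and I :: "(nat \<Rightarrow>\<^sub>0 nat) set"
    using that by (induction I rule: infinite_finite_induct) (simp_all add: zero add)
  have "P (Poly_Mapping.single m (Poly_Mapping.lookup p m))" if "m \<in> Poly_Mapping.keys p" for m
  proof -
    have "i < n" if "i \<in> Poly_Mapping.keys m" for i
      using p \<open>m \<in> _\<close> that by (auto simp: pol_ring_def)
    then show ?thesis
      unfolding single_eq_const_times_vars by (intro mult const prod power var)
  qed
  then have "P (\<Sum>m\<in>Poly_Mapping.keys p. Poly_Mapping.single m (Poly_Mapping.lookup p m))"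
    by (rule sum)
  then show ?thesis by (simp add: sum_single_lookup)
qed

lemma mpol_induct [case_names const var add mult]:
  fixes p :: "'k::field mpol"
  assumes "\<And>c. P (const_pol c)" and "\<And>i. P (var i)"
    and "\<And>p q. P p \<Longrightarrow> P q \<Longrightarrow> P (p + q)" and "\<And>p q. P p \<Longrightarrow> P q \<Longrightarrow> P (p * q)"
  shows "P p"
proof -
  obtain n where "p \<in> pol_ring n" using in_some_pol_ring by blast
  then show ?thesis by (induction rule: pol_ring_induct) (use assms in auto)
qed

section \<open>Evaluation homomorphisms\<close>

definition eval_mon :: "(nat \<Rightarrow> 'b::comm_ring_1) \<Rightarrow> (nat \<Rightarrow>\<^sub>0 nat) \<Rightarrow> 'b"
  where "eval_mon b m = (\<Prod>i\<in>Poly_Mapping.keys m. b i ^ Poly_Mapping.lookup m i)"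

text \<open>
  The coefficients are pushed along \<open>\<phi>\<close> and \<open>b i\<close> is substituted for the \<open>i\<close>-th variable. The target
  is an arbitrary commutative ring because three instances occur: the pullback along a linear map,
  the grading by a weight, and the reading of a polynomial as a univariate one over the others.
\<close>

definition eval_pol :: "('k::field \<Rightarrow> 'b::comm_ring_1) \<Rightarrow> (nat \<Rightarrow> 'b) \<Rightarrow> 'k mpol \<Rightarrow> 'b"
  where "eval_pol \<phi> b p = (\<Sum>m\<in>Poly_Mapping.keys p. \<phi> (Poly_Mapping.lookup p m) * eval_mon b m)"

lemma eval_mon_superset:
  assumes "finite A" "Poly_Mapping.keys m \<subseteq> A"
  shows "eval_mon b m = (\<Prod>i\<in>A. b i ^ Poly_Mapping.lookup m i)"
  unfolding eval_mon_def by (rule prod.mono_neutral_left) (use assms in \<open>auto simp: in_keys_iff\<close>)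

lemma eval_mon_add: "eval_mon b (m + m') = eval_mon b m * eval_mon b m'"
proof -
  let ?A = "Poly_Mapping.keys m \<union> Poly_Mapping.keys m'"
  have "eval_mon b (m + m') = (\<Prod>i\<in>?A. b i ^ Poly_Mapping.lookup (m + m') i)"
    by (rule eval_mon_superset) (simp_all add: keys_add)
  moreover have "eval_mon b m = (\<Prod>i\<in>?A. b i ^ Poly_Mapping.lookup m i)"
    by (rule eval_mon_superset) simp_all
  moreover have "eval_mon b m' = (\<Prod>i\<in>?A. b i ^ Poly_Mapping.lookup m' i)"
    by (rule eval_mon_superset) simp_all
  ultimately show ?thesis
    by (simp add: lookup_add power_add prod.distrib)
qed

locale coeff_hom =
  fixes \<phi> :: "'k::field \<Rightarrow> 'b::comm_ring_1"
  assumes hom_0: "\<phi> 0 = 0" and hom_1: "\<phi> 1 = 1"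
    and hom_add: "\<phi> (x + y) = \<phi> x + \<phi> y" and hom_mult: "\<phi> (x * y) = \<phi> x * \<phi> y"
begin

lemma eval_pol_superset:
  assumes "finite A" "Poly_Mapping.keys p \<subseteq> A"
  shows "eval_pol \<phi> b p = (\<Sum>m\<in>A. \<phi> (Poly_Mapping.lookup p m) * eval_mon b m)"
  unfolding eval_pol_def
  by (rule sum.mono_neutral_left) (use assms in \<open>auto simp: in_keys_iff hom_0\<close>)

lemma eval_pol_single: "eval_pol \<phi> b (Poly_Mapping.single m c) = \<phi> c * eval_mon b m"
  by (simp add: eval_pol_def hom_0)

lemma eval_pol_const [simp]: "eval_pol \<phi> b (const_pol c) = \<phi> c"
  by (simp add: const_pol_def eval_pol_single eval_mon_def)

lemma eval_pol_var [simp]: "eval_pol \<phi> b (var i) = b i"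
  by (simp add: var_def eval_pol_single eval_mon_def hom_1)

lemma eval_pol_0 [simp]: "eval_pol \<phi> b 0 = 0"
  by (simp add: eval_pol_def)

lemma eval_pol_1 [simp]: "eval_pol \<phi> b 1 = 1"
  using eval_pol_const[of b 1] by (simp add: hom_1)

lemma eval_pol_add [simp]: "eval_pol \<phi> b (p + q) = eval_pol \<phi> b p + eval_pol \<phi> b q"
proof -
  let ?A = "Poly_Mapping.keys p \<union> Poly_Mapping.keys q"
  have "eval_pol \<phi> b (p + q) = (\<Sum>m\<in>?A. \<phi> (Poly_Mapping.lookup (p + q) m) * eval_mon b m)"
    by (rule eval_pol_superset) (simp_all add: keys_add)
  moreover have "eval_pol \<phi> b p = (\<Sum>m\<in>?A. \<phi> (Poly_Mapping.lookup p m) * eval_mon b m)"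
    by (rule eval_pol_superset) simp_all
  moreover have "eval_pol \<phi> b q = (\<Sum>m\<in>?A. \<phi> (Poly_Mapping.lookup q m) * eval_mon b m)"
    by (rule eval_pol_superset) simp_all
  ultimately show ?thesis
    by (simp add: lookup_add hom_add distrib_right sum.distrib)
qed

lemma eval_pol_sum: "eval_pol \<phi> b (sum f I) = (\<Sum>i\<in>I. eval_pol \<phi> b (f i))"
  by (induction I rule: infinite_finite_induct) simp_all

lemma eval_pol_mult [simp]: "eval_pol \<phi> b (p * q) = eval_pol \<phi> b p * eval_pol \<phi> b q"
proof -
  let ?mon = "\<lambda>p m. Poly_Mapping.single m (Poly_Mapping.lookup p m)"
  have "eval_pol \<phi> b (p * q) =
      eval_pol \<phi> b ((\<Sum>m\<in>Poly_Mapping.keys p. ?mon p m) * (\<Sum>m\<in>Poly_Mapping.keys q. ?mon q m))"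
    by (simp add: sum_single_lookup)
  also have "\<dots> = eval_pol \<phi> b (\<Sum>m\<in>Poly_Mapping.keys p. ?mon p m) *
      eval_pol \<phi> b (\<Sum>m\<in>Poly_Mapping.keys q. ?mon q m)"
    by (simp add: sum_product eval_pol_sum mult_single eval_pol_single eval_mon_add hom_mult mult_ac)
  finally show ?thesis by (simp add: sum_single_lookup)
qed

lemma eval_pol_diff [simp]: "eval_pol \<phi> b (p - q) = eval_pol \<phi> b p - eval_pol \<phi> b q"
  using eval_pol_add[of b "p - q" q] by simp

lemma eval_pol_power [simp]: "eval_pol \<phi> b (p ^ k) = eval_pol \<phi> b p ^ k"
  by (induction k) simp_all

end

interpretation const_hom: coeff_hom const_pol
  by standard (simp_all add: const_pol_add const_pol_mult)

interpretation poly_const_hom: coeff_hom "\<lambda>c. [:const_pol c:]"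
  by standard (simp_all add: const_pol_add const_pol_mult)

section \<open>Degrees\<close>

definition weight :: "(nat \<Rightarrow> nat) \<Rightarrow> (nat \<Rightarrow>\<^sub>0 nat) \<Rightarrow> nat"
  where "weight w m = (\<Sum>i\<in>Poly_Mapping.keys m. w i * Poly_Mapping.lookup m i)"

text \<open>
  The homomorphism \<open>x\<^sub>i \<mapsto> x\<^sub>i T\<^bsup>w i\<^esup>\<close>, which records the weight of every monomial in the exponent of the new
  variable \<open>T\<close>. The weighted degree becomes a degree in \<open>T\<close>, and additivity of degrees under
  products is inherited from univariate polynomials over an integral domain.
\<close>

definition grade :: "(nat \<Rightarrow> nat) \<Rightarrow> 'k::field mpol \<Rightarrow> 'k mpol poly"
  where "grade w = eval_pol (\<lambda>c. [:const_pol c:]) (\<lambda>i. monom (var i) (w i))"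

lemma grade_simps [simp]:
  "grade w (p * q) = grade w p * grade w q" "grade w (p + q) = grade w p + grade w q"
  "grade w 0 = 0" "grade w 1 = 1"
  by (simp_all add: grade_def)

lemma prod_monom: "(\<Prod>i\<in>I. monom (f i) (k i)) = monom (prod f I) (sum k I)"
  by (induction I rule: infinite_finite_induct) (simp_all add: mult_monom)

lemma grade_single:
  fixes c :: "'k::field"
  shows "grade w (Poly_Mapping.single m c) = monom (Poly_Mapping.single m c) (weight w m)"
proof -
  have "eval_mon (\<lambda>i. monom (var i :: 'k mpol) (w i)) m =
      monom (\<Prod>i\<in>Poly_Mapping.keys m. var i ^ Poly_Mapping.lookup m i) (weight w m)"
    by (simp add: eval_mon_def monom_power weight_def prod_monom mult_ac)
  then show ?thesis
    unfolding grade_def poly_const_hom.eval_pol_single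
    by (simp add: single_eq_const_times_vars[of m c] smult_monom)
qed

lemma grade_eq: "grade w p =
    (\<Sum>m\<in>Poly_Mapping.keys p. monom (Poly_Mapping.single m (Poly_Mapping.lookup p m)) (weight w m))"
proof -
  have "grade w p = grade w (\<Sum>m\<in>Poly_Mapping.keys p. Poly_Mapping.single m (Poly_Mapping.lookup p m))"
    by (simp add: sum_single_lookup)
  also have "\<dots> = (\<Sum>m\<in>Poly_Mapping.keys p. monom (Poly_Mapping.single m (Poly_Mapping.lookup p m)) (weight w m))"
    unfolding grade_def poly_const_hom.eval_pol_sum by (simp add: grade_single flip: grade_def)
  finally show ?thesis .
qed

lemma lookup_coeff_grade:
  "Poly_Mapping.lookup (coeff (grade w p) d) m = (if weight w m = d then Poly_Mapping.lookup p m else 0)"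
proof -
  have "Poly_Mapping.lookup (coeff (grade w p) d) m =
      (\<Sum>m'\<in>Poly_Mapping.keys p. if m = m' then if weight w m = d then Poly_Mapping.lookup p m else 0 else 0)"
    unfolding grade_eq coeff_sum lookup_sum
    by (rule sum.cong) (auto simp: lookup_single when_def)
  then show ?thesis by (simp add: in_keys_iff)
qed

lemma grade_eq_0_iff [simp]: "grade w p = 0 \<longleftrightarrow> p = 0"
proof
  assume "grade w p = 0"
  then have "Poly_Mapping.lookup p m = 0" for m
    using lookup_coeff_grade[of w p "weight w m" m] by simp
  then show "p = 0" by (intro poly_mapping_eqI) simp
qed simp

lemma degree_grade: "degree (grade w p) = Max (insert 0 (weight w ` Poly_Mapping.keys p))"
proof (rule antisym)
  show "degree (grade w p) \<le> Max (insert 0 (weight w ` Poly_Mapping.keys p))"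
  proof (rule degree_le, intro allI impI)
    fix d assume "Max (insert 0 (weight w ` Poly_Mapping.keys p)) < d"
    then have "\<forall>m\<in>Poly_Mapping.keys p. weight w m \<noteq> d" by auto
    then show "coeff (grade w p) d = 0"
      by (intro poly_mapping_eqI) (auto simp: lookup_coeff_grade in_keys_iff)
  qed
  have "weight w m \<le> degree (grade w p)" if "m \<in> Poly_Mapping.keys p" for m
  proof (rule le_degree)
    show "coeff (grade w p) (weight w m) \<noteq> 0"
      using lookup_coeff_grade[of w p "weight w m" m] that by (auto simp: in_keys_iff)
  qed
  then show "Max (insert 0 (weight w ` Poly_Mapping.keys p)) \<le> degree (grade w p)"
    by auto
qed

lemma tot_degree_eq_degree: "tot_degree p = degree (grade (\<lambda>_. 1) p)"
  by (simp add: tot_degree_def degree_grade weight_def mon_degree_def[abs_def])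

text \<open>
  Being free of the variables from the \<open>n\<close>-th on is the vanishing of a weighted degree, so additivity
  of that degree shows that divisors of nonzero elements of \<open>pol_ring n\<close> stay in \<open>pol_ring n\<close>.
  Hence divisibility and irreducibility may always refer to the ring in all variables.
\<close>

lemma in_pol_ring_iff_degree:
  "p \<in> pol_ring n \<longleftrightarrow> degree (grade (\<lambda>i. if i < n then 0 else 1) p) = 0"
proof -
  have *: "weight (\<lambda>i. if i < n then 0 else 1) m = 0 \<longleftrightarrow> Poly_Mapping.keys m \<subseteq> {..<n}" for m
    by (auto simp: weight_def in_keys_iff subset_iff)
  have "degree (grade (\<lambda>i. if i < n then 0 else 1) p) = 0 \<longleftrightarrow>
      (\<forall>m\<in>Poly_Mapping.keys p. weight (\<lambda>i. if i < n then 0 else 1) m = 0)"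
    unfolding degree_grade by (auto simp: Max_eq_iff)
  then show ?thesis by (simp add: pol_ring_def *)
qed

lemma tot_degree_mult: "p \<noteq> 0 \<Longrightarrow> q \<noteq> 0 \<Longrightarrow> tot_degree (p * q) = tot_degree p + tot_degree q"
  by (simp add: tot_degree_eq_degree degree_mult_eq)

lemma tot_degree_mult_le: "tot_degree (p * q) \<le> tot_degree p + tot_degree q"
  by (simp add: tot_degree_eq_degree degree_mult_le)

lemma tot_degree_add_le: "tot_degree p \<le> d \<Longrightarrow> tot_degree q \<le> d \<Longrightarrow> tot_degree (p + q) \<le> d"
  by (simp add: tot_degree_eq_degree degree_add_le)

lemma tot_degree_const [simp]: "tot_degree (const_pol c) = 0"
  by (simp add: tot_degree_def const_pol_def mon_degree_def)

lemma tot_degree_0 [simp]: "tot_degree 0 = 0"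
  and tot_degree_1 [simp]: "tot_degree 1 = 0"
  by (simp_all add: tot_degree_eq_degree)

lemma divisor_in_pol_ring:
  assumes "p * q \<in> pol_ring n" "p * q \<noteq> 0"
  shows "p \<in> pol_ring n" "q \<in> pol_ring n"
  using assms by (auto simp: in_pol_ring_iff_degree degree_mult_eq)

lemma tot_degree_0_imp_const:
  assumes "tot_degree p = 0"
  shows "\<exists>c. p = const_pol c"
proof
  have "mon_degree m = 0" if "m \<in> Poly_Mapping.keys p" for m
    using assms that unfolding tot_degree_def by (auto simp: Max_eq_iff)
  then have "m = 0" if "m \<in> Poly_Mapping.keys p" for m
    using that by (auto simp: mon_degree_def in_keys_iff intro!: poly_mapping_eqI)
  then show "p = const_pol (Poly_Mapping.lookup p 0)"
    by (intro poly_mapping_eqI) (auto simp: const_pol_def lookup_single when_def in_keys_iff)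
qed

lemma unit_iff_tot_degree:
  assumes "p \<noteq> 0"
  shows "p dvd 1 \<longleftrightarrow> tot_degree p = 0"
proof
  assume "p dvd 1"
  then obtain q where q: "1 = p * q" by (elim dvdE)
  then have "q \<noteq> 0" by auto
  with q assms tot_degree_mult[of p q] show "tot_degree p = 0" by simp
next
  assume "tot_degree p = 0"
  then obtain c where c: "p = const_pol c" using tot_degree_0_imp_const by blast
  with assms have "c \<noteq> 0" by auto
  with c have "p * const_pol (inverse c) = 1"
    by (simp flip: const_pol_mult)
  then show "p dvd 1" by (metis dvdI)
qed

lemma dvd_imp_tot_degree_le: "p dvd q \<Longrightarrow> q \<noteq> 0 \<Longrightarrow> tot_degree p \<le> tot_degree q"
  by (auto elim!: dvdE simp: tot_degree_mult)

section \<open>Unique factorization\<close>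

text \<open>
  A polynomial seen as a univariate polynomial in \<open>x\<^sub>n\<close> whose coefficients are free of \<open>x\<^sub>n\<close>. On
  \<open>pol_ring (Suc n)\<close> this is the identification with polynomials in one variable over \<open>pol_ring n\<close>
  that carries the induction on the number of variables; substituting \<open>x\<^sub>n\<close> is its inverse.
\<close>

definition split_var :: "nat \<Rightarrow> 'k::field mpol \<Rightarrow> 'k mpol poly"
  where "split_var n = eval_pol (\<lambda>c. [:const_pol c:]) (\<lambda>i. if i = n then [:0, 1:] else [:var i:])"

lemma split_var_simps [simp]:
  "split_var n (p * q) = split_var n p * split_var n q" "split_var n (p + q) = split_var n p + split_var n q"
  "split_var n (p - q) = split_var n p - split_var n q" "split_var n (p ^ k) = split_var n p ^ k"
  "split_var n 0 = 0"
  "split_var n (const_pol c) = [:const_pol c:]" "split_var n (var i) = (if i = n then [:0, 1:] else [:var i:])"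
  by (simp_all add: split_var_def)

lemma poly_split_var [simp]: "poly (split_var n p) (var n) = p"
  by (induction p rule: mpol_induct) simp_all

lemma split_var_eq_iff [simp]: "split_var n p = split_var n q \<longleftrightarrow> p = q"
  by (metis poly_split_var)

lemma split_var_eq_0_iff [simp]: "split_var n p = 0 \<longleftrightarrow> p = 0"
  using split_var_eq_iff[of n p 0] by (simp del: split_var_eq_iff)

lemma split_var_pol_ring: "p \<in> pol_ring n \<Longrightarrow> split_var n p = [:p:]"
  by (induction rule: pol_ring_induct) simp_all

lemma coeff_split_var_in_pol_ring: "p \<in> pol_ring (Suc n) \<Longrightarrow> coeff (split_var n p) i \<in> pol_ring n"
proof (induction arbitrary: i rule: pol_ring_induct)
  case (const c)
  then show ?case by (simp add: coeff_pCons split: nat.split)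
next
  case (var j)
  then show ?case by (auto simp: coeff_pCons split: nat.split)
next
  case (add p q)
  then show ?case by auto
next
  case (mult p q)
  then show ?case by (auto simp: coeff_mult)
qed

lemma const_dvd_split_var_iff:
  assumes "c \<in> pol_ring n"
  shows "[:c:] dvd split_var n p \<longleftrightarrow> c dvd p"
proof
  assume "[:c:] dvd split_var n p"
  then obtain P where "split_var n p = [:c:] * P" by (elim dvdE)
  then have "p = c * poly P (var n)"
    using poly_split_var[of n p] by simp
  then show "c dvd p" by simp
next
  assume "c dvd p"
  then obtain k where "p = c * k" by (elim dvdE)
  then have "split_var n p = [:c:] * split_var n k"
    using split_var_pol_ring[OF assms] by simp
  then show "[:c:] dvd split_var n p" by (rule dvdI)
qed

text \<open>
  The argument of Gauss: at the first coefficients of \<open>P\<close> and of \<open>Q\<close> that are not divisible by \<open>p\<close>,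
  all other summands of the corresponding coefficient of the product are divisible by \<open>p\<close>. Primality is
  only asked for on the coefficients that occur, so that \<open>p\<close> may be prime in a subring only.
\<close>

lemma const_poly_dvd_mult:
  fixes p :: "'a::comm_ring_1"
  assumes dvd: "\<And>n. p dvd coeff (P * Q) n"
    and prime: "\<And>i j. p dvd coeff P i * coeff Q j \<Longrightarrow> p dvd coeff P i \<or> p dvd coeff Q j"
  shows "(\<forall>n. p dvd coeff P n) \<or> (\<forall>n. p dvd coeff Q n)"
proof (rule ccontr)
  assume "\<not> ?thesis"
  then have exP: "\<exists>i. \<not> p dvd coeff P i" and exQ: "\<exists>j. \<not> p dvd coeff Q j" by auto
  define i where "i = (LEAST i. \<not> p dvd coeff P i)"
  define j where "j = (LEAST j. \<not> p dvd coeff Q j)"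
  have i: "\<not> p dvd coeff P i" unfolding i_def using exP by (rule LeastI_ex)
  have j: "\<not> p dvd coeff Q j" unfolding j_def using exQ by (rule LeastI_ex)
  have less_i: "p dvd coeff P k" if "k < i" for k
    using not_less_Least[of k "\<lambda>i. \<not> p dvd coeff P i"] that unfolding i_def by blast
  have less_j: "p dvd coeff Q k" if "k < j" for k
    using not_less_Least[of k "\<lambda>j. \<not> p dvd coeff Q j"] that unfolding j_def by blast
  have "coeff (P * Q) (i + j) = (\<Sum>k\<le>i + j. coeff P k * coeff Q (i + j - k))"
    by (simp add: coeff_mult)
  also have "\<dots> = coeff P i * coeff Q j + (\<Sum>k\<in>{..i + j} - {i}. coeff P k * coeff Q (i + j - k))"
    by (subst sum.remove[where x = i]) simp_all
  finally have eq: "coeff P i * coeff Q j =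
      coeff (P * Q) (i + j) - (\<Sum>k\<in>{..i + j} - {i}. coeff P k * coeff Q (i + j - k))"
    by (simp add: algebra_simps)
  have "p dvd (\<Sum>k\<in>{..i + j} - {i}. coeff P k * coeff Q (i + j - k))"
  proof (rule dvd_sum)
    fix k assume "k \<in> {..i + j} - {i}"
    then have "k < i \<or> i + j - k < j" by auto
    then show "p dvd coeff P k * coeff Q (i + j - k)"
      using less_i less_j by auto
  qed
  with dvd have "p dvd coeff P i * coeff Q j"
    unfolding eq by (intro dvd_diff)
  then show False using prime i j by blast
qed

text \<open>
  The elements are taken from \<open>R\<close>, but divisibility and irreducibility are those of the whole ring; for
  nonzero elements of \<open>pol_ring n\<close> they agree with the notions inside \<open>pol_ring n\<close>.
\<close>

definition irreducibles_prime :: "'k::field mpol set \<Rightarrow> bool" where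
  "irreducibles_prime R \<longleftrightarrow> (\<forall>p\<in>R. \<forall>a\<in>R. \<forall>b\<in>R. irreducible p \<longrightarrow> p dvd a * b \<longrightarrow> p dvd a \<or> p dvd b)"

definition primitive_over :: "'k::field mpol set \<Rightarrow> 'k mpol \<Rightarrow> bool" where
  "primitive_over R h \<longleftrightarrow> (\<forall>c\<in>R. c dvd h \<longrightarrow> c dvd 1)"

lemma irreducible_divisor_exists:
  fixes p :: "'k::field mpol"
  assumes "p \<noteq> 0" "\<not> p dvd 1"
  shows "\<exists>q. irreducible q \<and> q dvd p"
  using assms
proof (induction "tot_degree p" arbitrary: p rule: less_induct)
  case less
  show ?case
  proof (cases "irreducible p")
    case False
    then obtain a b where ab: "p = a * b" "\<not> a dvd 1" "\<not> b dvd 1"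
      using less.prems by (auto simp: irreducible_def)
    then have "tot_degree a < tot_degree p"
      using less.prems by (auto simp: tot_degree_mult unit_iff_tot_degree)
    then obtain q where "irreducible q" "q dvd a"
      using less.hyps[of a] ab less.prems by auto
    then show ?thesis using ab by auto
  qed auto
qed

lemma primitive_part_exists:
  fixes h :: "'k::field mpol"
  assumes "h \<noteq> 0"
  shows "\<exists>c\<in>pol_ring n. \<exists>h0. h = c * h0 \<and> primitive_over (pol_ring n) h0"
  using assms
proof (induction "tot_degree h" arbitrary: h rule: less_induct)
  case less
  show ?case
  proof (cases "primitive_over (pol_ring n) h")
    case True
    then show ?thesis by (intro bexI[of _ 1] exI[of _ h]) auto
  next
    case False
    then obtain c h' where c: "c \<in> pol_ring n" "\<not> c dvd 1" "h = c * h'"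
      unfolding primitive_over_def by (metis dvdE)
    then have "tot_degree h' < tot_degree h"
      using less.prems by (auto simp: tot_degree_mult unit_iff_tot_degree)
    then obtain c' h0 where "c' \<in> pol_ring n" "h' = c' * h0" "primitive_over (pol_ring n) h0"
      using less.hyps[of h'] less.prems c by auto
    with c show ?thesis
      by (intro bexI[of _ "c * c'"] exI[of _ h0]) (auto simp: mult_ac)
  qed
qed

text \<open>
  The part of Gauss's lemma that concerns irreducibles not involving the new variable: they divide a
  polynomial exactly if they divide all of its coefficients.
\<close>

lemma irreducible_coefficient_prime:
  fixes p :: "'k::field mpol"
  assumes prime: "irreducibles_prime (pol_ring n :: 'k mpol set)"
    and p: "p \<in> pol_ring n" "irreducible p"
    and ab: "a \<in> pol_ring (Suc n)" "b \<in> pol_ring (Suc n)" "p dvd a * b"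
  shows "p dvd a \<or> p dvd b"
proof -
  have "[:p:] dvd split_var n a * split_var n b"
    using const_dvd_split_var_iff[OF p(1), of "a * b"] ab by simp
  moreover have "p dvd x \<or> p dvd y" if "x \<in> pol_ring n" "y \<in> pol_ring n" "p dvd x * y" for x y
    using prime p that unfolding irreducibles_prime_def by blast
  ultimately have "(\<forall>i. p dvd coeff (split_var n a) i) \<or> (\<forall>i. p dvd coeff (split_var n b) i)"
    using coeff_split_var_in_pol_ring[OF ab(1)] coeff_split_var_in_pol_ring[OF ab(2)]
    by (intro const_poly_dvd_mult) (auto simp: const_poly_dvd_iff)
  then show ?thesis
    by (simp flip: const_poly_dvd_iff add: const_dvd_split_var_iff[OF p(1)])
qed

text \<open>
  This replaces the passage to the fraction field of the coefficient ring: a primitive polynomial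
  that divides \<open>c\<close> up to a coefficient \<open>m\<close> divides \<open>c\<close>, since each prime factor of \<open>m\<close> must divide the
  cofactor and can be cancelled.
\<close>

lemma dvd_cancel_coefficient:
  fixes h :: "'k::field mpol"
  assumes prime: "irreducibles_prime (pol_ring n :: 'k mpol set)"
    and h: "primitive_over (pol_ring n) h" "h \<in> pol_ring (Suc n)"
    and c: "c \<in> pol_ring (Suc n)"
    and m: "m \<in> pol_ring n" "m \<noteq> 0" "h dvd m * c"
  shows "h dvd c"
  using m
proof (induction "tot_degree m" arbitrary: m rule: less_induct)
  case less
  show ?case
  proof (cases "m dvd 1 \<or> c = 0")
    case True
    then show ?thesis
    proof
      assume "m dvd 1"
      then have "m * c dvd 1 * c" by (intro mult_dvd_mono) auto
      then show ?thesis using less.prems dvd_trans[of h "m * c" c] by simp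
    qed simp
  next
    case False
    then obtain p where p: "irreducible p" "p dvd m"
      using irreducible_divisor_exists less.prems by blast
    then obtain m' where m': "m = p * m'" by (elim dvdE)
    have pR: "p \<in> pol_ring n" and m'R: "m' \<in> pol_ring n"
      using divisor_in_pol_ring m' less.prems by blast+
    obtain t where t: "m * c = h * t" using less.prems by (elim dvdE)
    have "m \<in> pol_ring (Suc n)" using less.prems pol_ring_mono[of n "Suc n"] by auto
    then have "t \<in> pol_ring (Suc n)"
      using divisor_in_pol_ring(2)[of h t "Suc n"] t c False less.prems by (metis mult_in_pol_ring mult_eq_0_iff)
    moreover have "p dvd h * t" using t m' by (metis dvd_triv_left mult.assoc)
    moreover have "\<not> p dvd h" using h p pR by (auto simp: primitive_over_def irreducible_def)
    ultimately have "p dvd t"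
      using irreducible_coefficient_prime[OF prime pR p(1) h(2)] by blast
    then obtain t' where t': "t = p * t'" by (elim dvdE)
    have "p * (m' * c) = p * (h * t')" using t t' m' by (simp add: mult_ac)
    then have "m' * c = h * t'" using p by auto
    then have "h dvd m' * c" by simp
    moreover have "m' \<noteq> 0" using m' less.prems by auto
    moreover have "tot_degree m' < tot_degree m"
      using p m' less.prems by (auto simp: tot_degree_mult irreducible_def unit_iff_tot_degree)
    ultimately show ?thesis using less.hyps m'R by blast
  qed
qed

lemma degree_lt_if_coeff_0:
  fixes p :: "'a::zero poly"
  assumes "degree p \<le> d" "coeff p d = 0"
  shows "p = 0 \<or> degree p < d"
  using assms by (metis le_neq_implies_less leading_coeff_0_iff)

text \<open>
  Over the fraction field of the coefficients, an element of minimal degree generates the ideal \<open>I\<close>.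
  Without denominators: the leading terms of \<open>c\<close> and of a shift of \<open>h\<close> are made equal by multiplying with each
  other's leading coefficients, and the difference lies in \<open>I\<close> and has smaller degree.
\<close>

lemma minimal_degree_pseudo_divides:
  fixes h :: "'k::field mpol"
  assumes I_sub: "I \<subseteq> pol_ring (Suc n)"
    and I_diff: "\<And>x y. x \<in> I \<Longrightarrow> y \<in> I \<Longrightarrow> x - y \<in> I"
    and I_mult: "\<And>r x. r \<in> pol_ring (Suc n) \<Longrightarrow> x \<in> I \<Longrightarrow> r * x \<in> I"
    and h: "h \<in> I" "h \<noteq> 0"
    and min: "\<And>x. x \<in> I \<Longrightarrow> x \<noteq> 0 \<Longrightarrow> degree (split_var n h) \<le> degree (split_var n x)"
    and "c \<in> I"
  shows "\<exists>m\<in>pol_ring n. m \<noteq> 0 \<and> h dvd m * c"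
proof -
  have "\<exists>m\<in>pol_ring n. m \<noteq> 0 \<and> h dvd m * c"
    \<comment> \<open>The zero polynomial has degree 0 by convention and is therefore admitted separately.\<close>
    if "c \<in> I" "c = 0 \<or> degree (split_var n c) < N" for N c
    using that
  proof (induction N arbitrary: c)
    case 0
    then show ?case by (intro bexI[of _ 1]) auto
  next
    case (Suc N)
    show ?case
    proof (cases "c = 0 \<or> degree (split_var n c) < N")
      case False
      define l where "l = lead_coeff (split_var n h)"
      define l' where "l' = lead_coeff (split_var n c)"
      define k where "k = degree (split_var n c) - degree (split_var n h)"
      define c' where "c' = l * c - l' * var n ^ k * h"
      have deg: "degree (split_var n c) = degree (split_var n h) + k" "degree (split_var n c) = N"
        using min[of c] Suc.prems False by (auto simp: k_def)
      have l: "l \<in> pol_ring n" "l' \<in> pol_ring n" "l \<noteq> 0"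
        using Suc.prems I_sub h by (auto simp: l_def l'_def intro!: coeff_split_var_in_pol_ring)
      have l_Suc: "l \<in> pol_ring (Suc n)" "l' \<in> pol_ring (Suc n)"
        using l pol_ring_mono[of n "Suc n"] by auto
      have "c' \<in> I"
        unfolding c'_def using l_Suc Suc.prems h
        by (intro I_diff I_mult mult_in_pol_ring power_in_pol_ring var_in_pol_ring) auto
      moreover have "split_var n c' = 0 \<or> degree (split_var n c') < N"
      proof (rule degree_lt_if_coeff_0)
        have eq: "split_var n c' = smult l (split_var n c) - smult l' (monom 1 k * split_var n h)"
          using l by (simp add: c'_def split_var_pol_ring monom_altdef mult.assoc)
        have "degree (smult l (split_var n c)) \<le> N"
          using degree_smult_le[of l "split_var n c"] deg by simp
        moreover have "degree (smult l' (monom 1 k * split_var n h)) \<le> N"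
          using degree_smult_le[of l' "monom 1 k * split_var n h"] degree_mult_le[of "monom 1 k" "split_var n h"]
            degree_monom_le[of "1::'k mpol" k] deg by linarith
        ultimately show "degree (split_var n c') \<le> N" unfolding eq by (rule degree_diff_le)
        have "coeff (monom 1 k * split_var n h) (k + degree (split_var n h)) = l"
          by (simp add: coeff_monom_mult l_def)
        then show "coeff (split_var n c') N = 0"
          unfolding eq using deg by (simp add: l'_def add.commute)
      qed
      ultimately obtain m' where m': "m' \<in> pol_ring n" "m' \<noteq> 0" "h dvd m' * c'"
        using Suc.IH[of c'] by auto
      have "m' * l * c = m' * c' + m' * l' * var n ^ k * h"
        by (simp add: c'_def algebra_simps)
      then have "h dvd m' * l * c" using m' by simp
      then show ?thesis using m' l by (intro bexI[of _ "m' * l"]) auto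
    qed (use Suc in auto)
  qed
  then show ?thesis using \<open>c \<in> I\<close> by blast
qed

text \<open>
  Let \<open>p\<close> be irreducible in \<open>n + 1\<close> variables and divide \<open>a * b\<close>. If a nonunit in \<open>n\<close> variables
  divides \<open>p\<close>, it is associated to \<open>p\<close>, and the claim is about an irreducible coefficient. Otherwise \<open>p\<close> is
  primitive. An element of minimal degree of the ideal \<open>(p, a)\<close>, freed of its content, then divides both
  \<open>p\<close> and \<open>a\<close>. By irreducibility it is either associated to \<open>p\<close>, so that \<open>p\<close> divides \<open>a\<close>, or a unit; in
  that case the ideal contains a nonzero coefficient \<open>e\<close>, \<open>p\<close> divides \<open>e * b\<close>, and \<open>e\<close> can be cancelled.
\<close>

lemma irreducibles_prime_pol_ring: "irreducibles_prime (pol_ring n :: 'k::field mpol set)"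
proof (induction n)
  case 0
  have "p dvd 1" if "p \<in> pol_ring 0" "p \<noteq> 0" for p :: "'k mpol"
    using that by (simp add: in_pol_ring_iff_degree unit_iff_tot_degree tot_degree_eq_degree)
  then show ?case by (auto simp: irreducibles_prime_def irreducible_def)
next
  case (Suc n)
  show ?case unfolding irreducibles_prime_def
  proof (intro ballI impI)
    fix p a b :: "'k mpol"
    assume p: "p \<in> pol_ring (Suc n)" and a: "a \<in> pol_ring (Suc n)" and b: "b \<in> pol_ring (Suc n)"
      and irr: "irreducible p" and dvd: "p dvd a * b"
    show "p dvd a \<or> p dvd b"
    proof (cases "primitive_over (pol_ring n) p")
      case False
      then obtain c u where c: "c \<in> pol_ring n" "\<not> c dvd 1" "p = c * u"
        unfolding primitive_over_def by (metis dvdE)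
      then have "u dvd 1" using irr by (auto simp: irreducible_def)
      then have pc: "p dvd c" using c mult_dvd_mono[of c c u 1] by simp
      have "irreducible c" using irreducible_mono[OF irr, of c] c by auto
      then have "c dvd a \<or> c dvd b"
        using irreducible_coefficient_prime[OF Suc.IH c(1) _ a b] c dvd dvd_mult_left by blast
      then show ?thesis using pc dvd_trans by blast
    next
      case True
      define I where "I = {u * p + v * a | u v. u \<in> pol_ring (Suc n) \<and> v \<in> pol_ring (Suc n)}"
      have pI: "p \<in> I" unfolding I_def by (intro CollectI exI[of _ 1] exI[of _ 0]) auto
      have aI: "a \<in> I" unfolding I_def by (intro CollectI exI[of _ 0] exI[of _ 1]) auto
      have I_sub: "I \<subseteq> pol_ring (Suc n)" using p a by (auto simp: I_def)
      have I_diff: "x - y \<in> I" if xy: "x \<in> I" "y \<in> I" for x y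
      proof -
        obtain u v u' v' where "x = u * p + v * a" "y = u' * p + v' * a"
          "u \<in> pol_ring (Suc n)" "v \<in> pol_ring (Suc n)" "u' \<in> pol_ring (Suc n)" "v' \<in> pol_ring (Suc n)"
          using xy unfolding I_def by blast
        then show ?thesis unfolding I_def
          by (intro CollectI exI[of _ "u - u'"] exI[of _ "v - v'"]) (auto simp: algebra_simps)
      qed
      have I_mult: "r * x \<in> I" if rx: "r \<in> pol_ring (Suc n)" "x \<in> I" for r x
      proof -
        obtain u v where "x = u * p + v * a" "u \<in> pol_ring (Suc n)" "v \<in> pol_ring (Suc n)"
          using rx unfolding I_def by blast
        then show ?thesis unfolding I_def using rx
          by (intro CollectI exI[of _ "r * u"] exI[of _ "r * v"]) (auto simp: algebra_simps)
      qed
      obtain h where h: "h \<in> I" "h \<noteq> 0" and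
        min: "\<And>x. x \<in> I \<Longrightarrow> x \<noteq> 0 \<Longrightarrow> degree (split_var n h) \<le> degree (split_var n x)"
        using ex_has_least_nat[of "\<lambda>x. x \<in> I \<and> x \<noteq> 0" p "\<lambda>x. degree (split_var n x)"] pI irr
        by (auto simp: irreducible_def)
      obtain e h0 where e: "e \<in> pol_ring n" "h = e * h0" "primitive_over (pol_ring n) h0"
        using primitive_part_exists[OF h(2)] by blast
      have h0: "h0 \<in> pol_ring (Suc n)"
        using divisor_in_pol_ring(2)[of e h0] e h I_sub by auto
      have h0_dvd: "h0 dvd x" if x: "x \<in> I" for x
      proof -
        obtain m where m: "m \<in> pol_ring n" "m \<noteq> 0" "h dvd m * x"
          using minimal_degree_pseudo_divides[OF I_sub I_diff I_mult h min x] by blast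
        then have "h0 dvd m * x" using e dvd_mult_right by blast
        then show ?thesis
          using dvd_cancel_coefficient[OF Suc.IH e(3) h0 _ m(1,2)] x I_sub by blast
      qed
      obtain t where t: "p = h0 * t" using h0_dvd[OF pI] by (elim dvdE)
      consider "t dvd 1" | "h0 dvd 1" using irreducibleD[OF irr t] by blast
      then show ?thesis
      proof cases
        case 1
        then have "p dvd h0" using t mult_dvd_mono[of h0 h0 t 1] by simp
        then show ?thesis using h0_dvd[OF aI] dvd_trans by blast
      next
        case 2
        obtain u v where "h = u * p + v * a" using h by (auto simp: I_def)
        then have "h * b = (u * b) * p + v * (a * b)" by (simp add: algebra_simps)
        then have "p dvd h * b" using dvd by simp
        also have "h * b dvd e * b" using 2 e mult_dvd_mono[of "e * b" "e * b" h0 1] by (simp add: mult_ac)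
        finally have "p dvd e * b" .
        moreover have "e \<noteq> 0" using e h by auto
        ultimately show ?thesis
          using dvd_cancel_coefficient[OF Suc.IH True p b e(1)] by blast
      qed
    qed
  qed
qed

lemma irreducible_imp_prime_elem_mpol:
  fixes p :: "'k::field mpol"
  assumes "irreducible p"
  shows "prime_elem p"
  unfolding prime_elem_def
proof (intro conjI allI impI)
  show "p \<noteq> 0" "\<not> p dvd 1" using assms by (auto simp: irreducible_def)
  fix a b assume "p dvd a * b"
  obtain i j k where "p \<in> pol_ring i" "a \<in> pol_ring j" "b \<in> pol_ring k"
    using in_some_pol_ring by metis
  then have "p \<in> pol_ring (i + j + k)" "a \<in> pol_ring (i + j + k)" "b \<in> pol_ring (i + j + k)"
    using pol_ring_mono[of i "i + j + k"] pol_ring_mono[of j "i + j + k"] pol_ring_mono[of k "i + j + k"] by auto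
  then show "p dvd a \<or> p dvd b"
    using irreducibles_prime_pol_ring[of "i + j + k"] assms \<open>p dvd a * b\<close>
    unfolding irreducibles_prime_def by blast
qed

text \<open>
  Euclid's lemma, by splitting off one prime factor of \<open>p\<close> after the other.
\<close>

lemma coprime_pol_dvd_mult:
  assumes "coprime_pol p q" "p dvd q * c"
  shows "p dvd c"
  using assms
proof (induction "tot_degree p" arbitrary: p c rule: less_induct)
  case less
  show ?case
  proof (cases "p = 0 \<or> p dvd 1")
    case True
    then show ?thesis
    proof
      assume "p = 0"
      then have "q dvd 1" "q * c = 0" using less.prems by (auto simp: coprime_pol_def)
      then show ?thesis by auto
    next
      assume "p dvd 1"
      then show ?thesis using dvd_trans one_dvd by blast
    qed
  next
    case False
    then obtain r p' where r: "irreducible r" "p = r * p'"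
      using irreducible_divisor_exists by (meson dvdE)
    have "\<not> r dvd q" using less.prems r by (auto simp: coprime_pol_def irreducible_def)
    moreover have "r dvd q * c" using less.prems(2) r dvd_mult_left by blast
    ultimately obtain c' where c': "c = r * c'"
      using irreducible_imp_prime_elem_mpol[OF r(1)] by (auto simp: prime_elem_dvd_mult_iff elim!: dvdE)
    obtain s where "q * c = p * s" using less.prems(2) by (elim dvdE)
    then have "r * (q * c') = r * (p' * s)" using r c' by (simp add: mult_ac)
    then have "q * c' = p' * s" using r by auto
    then have "p' dvd q * c'" by simp
    moreover have "coprime_pol p' q" using less.prems(1) r by (auto simp: coprime_pol_def)
    moreover have "tot_degree p' < tot_degree p"
      using r False by (auto simp: tot_degree_mult irreducible_def unit_iff_tot_degree)
    ultimately have "p' dvd c'" using less.hyps by blast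
    then show ?thesis using r c' by auto
  qed
qed

section \<open>Fractions in lowest terms\<close>

lemma coprime_pol_commute: "coprime_pol p q \<longleftrightarrow> coprime_pol q p"
  by (auto simp: coprime_pol_def)

lemma dvd_antisym_tot_degree: "p dvd q \<Longrightarrow> q dvd p \<Longrightarrow> tot_degree p = tot_degree q"
  using dvd_imp_tot_degree_le[of p q] dvd_imp_tot_degree_le[of q p] by force

text \<open>
  By Euclid's lemma two reduced representations of a fraction have mutually dividing numerators and
  mutually dividing denominators. Therefore the degree of a rational function may be computed from any
  reduced representation.
\<close>

lemma reduced_fraction_degree_unique:
  assumes "p * q' = p' * q" "coprime_pol p q" "coprime_pol p' q'"
  shows "tot_degree p = tot_degree p' \<and> tot_degree q = tot_degree q'"
proof -
  have "p dvd q * p'" "p' dvd q' * p" "q dvd p * q'" "q' dvd p' * q"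
    using assms(1) by (metis dvd_triv_left dvd_triv_right mult.commute)+
  then have "p dvd p'" "p' dvd p" "q dvd q'" "q' dvd q"
    using coprime_pol_dvd_mult assms(2,3) coprime_pol_commute by blast+
  then show ?thesis using dvd_antisym_tot_degree by blast
qed

lemma rat_degree_Fract:
  assumes "p \<in> pol_ring n" "q \<in> pol_ring n" "q \<noteq> 0" "coprime_pol p q"
  shows "rat_degree n (Fract p q) = tot_degree p + tot_degree q"
  unfolding rat_degree_def
proof (rule the_equality)
  show "\<exists>p'\<in>pol_ring n. \<exists>q'\<in>pol_ring n. q' \<noteq> 0 \<and> Fract p q = Fract p' q' \<and> coprime_pol p' q' \<and>
      tot_degree p + tot_degree q = tot_degree p' + tot_degree q'"
    using assms by blast
next
  fix d
  assume "\<exists>p'\<in>pol_ring n. \<exists>q'\<in>pol_ring n. q' \<noteq> 0 \<and> Fract p q = Fract p' q' \<and> coprime_pol p' q' \<and>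
      d = tot_degree p' + tot_degree q'"
  then obtain p' q' where "q' \<noteq> 0" "Fract p q = Fract p' q'" "coprime_pol p' q'"
    "d = tot_degree p' + tot_degree q'" by blast
  then show "d = tot_degree p + tot_degree q"
    using reduced_fraction_degree_unique[of p q' p' q] assms by (simp add: eq_fract)
qed

text \<open>
  A common nonunit factor is removed as long as there is one. The degree of the denominator drops each
  time, whereas the numerator may be zero and its degree need not drop.
\<close>

lemma reduced_fraction_exists:
  assumes "f \<in> rat_field n"
  shows "\<exists>p\<in>pol_ring n. \<exists>q\<in>pol_ring n. q \<noteq> 0 \<and> f = Fract p q \<and> coprime_pol p q"
proof -
  have "\<exists>p'\<in>pol_ring n. \<exists>q'\<in>pol_ring n. q' \<noteq> 0 \<and> Fract p q = Fract p' q' \<and> coprime_pol p' q'"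
    if "p \<in> pol_ring n" "q \<in> pol_ring n" "q \<noteq> 0" for p q :: "'a mpol"
    using that
  proof (induction "tot_degree q" arbitrary: p q rule: less_induct)
    case less
    show ?case
    proof (cases "coprime_pol p q")
      case False
      then obtain h p' q' where h: "\<not> h dvd 1" "p = h * p'" "q = h * q'"
        unfolding coprime_pol_def by (metis dvdE)
      then have ne: "h \<noteq> 0" "q' \<noteq> 0" using less.prems by auto
      have "Fract p q = Fract p' q'" using h ne by (simp add: eq_fract)
      moreover have "tot_degree q' < tot_degree q"
        using h ne by (auto simp: tot_degree_mult unit_iff_tot_degree)
      moreover have "q' \<in> pol_ring n" using divisor_in_pol_ring(2) h less.prems by blast
      moreover have "p' \<in> pol_ring n"
        using divisor_in_pol_ring(2)[of h p' n] h less.prems ne by (cases "p' = 0") auto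
      ultimately show ?thesis using less.hyps[of q' p'] ne by simp
    qed (use less.prems in blast)
  qed
  then show ?thesis using assms unfolding rat_field_def by blast
qed

section \<open>Generated subfields\<close>

lemma is_subfield_field_gen: "is_subfield (field_gen S)"
  unfolding field_gen_def by (rule hull_in) (auto simp: is_subfield_def)

lemma subset_field_gen: "S \<subseteq> field_gen S"
  unfolding field_gen_def by (auto intro: hull_inc)

lemma field_gen_least: "S \<subseteq> field_gen T \<Longrightarrow> field_gen S \<subseteq> field_gen T"
  using is_subfield_field_gen[of T] unfolding field_gen_def
  by (intro hull_minimal) (auto intro: hull_inc)

lemma field_gen_divide:
  assumes "pol_to_rat p \<in> field_gen S" "pol_to_rat q \<in> field_gen S" "q \<noteq> 0"
  shows "Fract p q \<in> field_gen S"
proof -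
  have "Fract p q = pol_to_rat p * inverse (pol_to_rat q)"
    by (simp add: pol_to_rat_def)
  then show ?thesis using assms is_subfield_field_gen[of S] by (auto simp: is_subfield_def)
qed

section \<open>The action on polynomials\<close>

lemma tot_degree_sum_le: "(\<And>i. i \<in> I \<Longrightarrow> tot_degree (f i) \<le> d) \<Longrightarrow> tot_degree (sum f I) \<le> d"
  by (induction I rule: infinite_finite_induct) (auto intro: tot_degree_add_le)

lemma tot_degree_prod_le: "tot_degree (prod f I) \<le> (\<Sum>i\<in>I. tot_degree (f i))"
proof (induction I rule: infinite_finite_induct)
  case (insert i I)
  then show ?case using tot_degree_mult_le[of "f i" "prod f I"] by simp
qed simp_all

lemma tot_degree_power_le: "tot_degree (p ^ k) \<le> k * tot_degree p"
proof (induction k)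
  case (Suc k)
  then show ?case using tot_degree_mult_le[of p "p ^ k"] by simp
qed simp

lemma tot_degree_eval_pol_le:
  assumes "\<And>i. tot_degree (b i) \<le> 1"
  shows "tot_degree (eval_pol const_pol b p) \<le> tot_degree p"
  unfolding eval_pol_def
proof (rule tot_degree_sum_le)
  fix m assume m: "m \<in> Poly_Mapping.keys p"
  have "tot_degree (eval_mon b m) \<le> (\<Sum>i\<in>Poly_Mapping.keys m. tot_degree (b i ^ Poly_Mapping.lookup m i))"
    unfolding eval_mon_def by (rule tot_degree_prod_le)
  also have "\<dots> \<le> mon_degree m"
    unfolding mon_degree_def
  proof (rule sum_mono)
    fix i
    have "Poly_Mapping.lookup m i * tot_degree (b i) \<le> Poly_Mapping.lookup m i * 1"
      using assms by (rule mult_le_mono2)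
    then show "tot_degree (b i ^ Poly_Mapping.lookup m i) \<le> Poly_Mapping.lookup m i"
      using tot_degree_power_le[of "b i" "Poly_Mapping.lookup m i"] by linarith
  qed
  also have "\<dots> \<le> tot_degree p"
    unfolding tot_degree_def using m by simp
  finally have "tot_degree (eval_mon b m) \<le> tot_degree p" .
  then show "tot_degree (const_pol (Poly_Mapping.lookup p m) * eval_mon b m) \<le> tot_degree p"
    using tot_degree_mult_le[of "const_pol (Poly_Mapping.lookup p m)" "eval_mon b m"] by simp
qed

text \<open>
  The pullback is a substitution of linear forms, so it is a ring homomorphism that does not raise degrees.
\<close>

lemma pullback_pol_eq_eval: "pullback_pol scale bs T = eval_pol const_pol (pullback_form scale bs T)"
  by (rule ext) (simp add: pullback_pol_def eval_pol_def eval_mon_def)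

lemma pullback_form_eq: "pullback_form scale bs T i =
    (\<Sum>j<length bs. const_pol (Modules.module.representation scale (set bs) (T (bs ! j)) (bs ! i)) * var j)"
  by (simp add: pullback_form_def const_pol_def var_def mult_single)

lemma tot_degree_var: "tot_degree (var i) = 1"
  by (simp add: tot_degree_def var_def mon_degree_def)

lemma tot_degree_pullback_pol_le: "tot_degree (pullback_pol scale bs T p) \<le> tot_degree p"
  unfolding pullback_pol_eq_eval
proof (rule tot_degree_eval_pol_le)
  fix i
  show "tot_degree (pullback_form scale bs T i) \<le> 1"
    unfolding pullback_form_eq
  proof (rule tot_degree_sum_le)
    fix j
    let ?c = "const_pol (Modules.module.representation scale (set bs) (T (bs ! j)) (bs ! i))"
    show "tot_degree (?c * var j) \<le> 1"
      using tot_degree_mult_le[of ?c "var j"] by (simp add: tot_degree_var)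
  qed
qed

context fd_representation
begin

abbreviation coord :: "'v \<Rightarrow> nat \<Rightarrow> 'k"
  where "coord v i \<equiv> representation (set bs) v (bs ! i)"

lemma coord_basis:
  assumes "i < length bs" "j < length bs"
  shows "coord (bs ! j) i = (if i = j then 1 else 0)"
  using representation_basis[OF independent_Basis, of "bs ! j"] assms distinct_basis
  by (simp add: nth_eq_iff_index_eq)

lemma coord_linear:
  assumes "Vector_Spaces.linear scale scale T"
  shows "coord (T v) i = (\<Sum>j<length bs. coord v j * coord (T (bs ! j)) i)"
proof -
  interpret T: Vector_Spaces.linear scale scale T by fact
  have "(\<Sum>b\<in>set bs. scale (representation (set bs) v b) b) = v"
    by (rule sum_representation_eq) (simp_all add: independent_Basis span_Basis)
  then have "T v = (\<Sum>b\<in>set bs. scale (representation (set bs) v b) (T b))"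
    by (metis (no_types, lifting) T.scale T.sum sum.cong)
  also have "\<dots> = (\<Sum>j<length bs. scale (coord v j) (T (bs ! j)))"
    by (rule sum.reindex_bij_betw[symmetric]) (simp add: bij_betw_nth[OF distinct_basis])
  finally show ?thesis
    by (simp add: representation_sum representation_scale independent_Basis span_Basis)
qed

lemma pullback_pol_id:
  assumes "p \<in> pol_ring (length bs)" "\<And>v. T v = v"
  shows "pullback_pol scale bs T p = p"
  using assms(1) unfolding pullback_pol_eq_eval
proof (induction rule: pol_ring_induct)
  case (var i)
  have "pullback_form scale bs T i = (\<Sum>j<length bs. if i = j then var j else 0)"
    unfolding pullback_form_eq using var by (intro sum.cong) (simp_all add: assms(2) coord_basis)
  then show ?case using var by simp
qed simp_all

text \<open>
  Pulling back reverses the order of composition. Together with the inverse in the definition of the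
  action, this makes it a left action.
\<close>

lemma pullback_pol_pullback_pol:
  assumes "Vector_Spaces.linear scale scale T"
  shows "pullback_pol scale bs S (pullback_pol scale bs T p) = pullback_pol scale bs (\<lambda>v. T (S v)) p"
  unfolding pullback_pol_eq_eval
proof (induction p rule: mpol_induct)
  case (var i)
  have "eval_pol const_pol (pullback_form scale bs S) (pullback_form scale bs T i)
    = (\<Sum>j<length bs. const_pol (coord (T (bs ! j)) i) * pullback_form scale bs S j)"
    by (simp add: pullback_form_eq[of _ _ T] const_hom.eval_pol_sum)
  also have "\<dots> = (\<Sum>j<length bs. \<Sum>k<length bs. const_pol (coord (S (bs ! k)) j * coord (T (bs ! j)) i) * var k)"
    by (simp add: pullback_form_eq[of _ _ S] sum_distrib_left const_pol_mult mult_ac)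
  also have "\<dots> = (\<Sum>k<length bs. \<Sum>j<length bs. const_pol (coord (S (bs ! k)) j * coord (T (bs ! j)) i) * var k)"
    by (rule sum.swap)
  also have "\<dots> = (\<Sum>k<length bs. const_pol (coord (T (S (bs ! k))) i) * var k)"
    unfolding coord_linear[OF assms, of "S _"] const_pol_sum sum_distrib_right ..
  also have "\<dots> = pullback_form scale bs (\<lambda>v. T (S v)) i"
    by (simp add: pullback_form_eq)
  finally show ?case by simp
qed simp_all

abbreviation act :: "'g \<Rightarrow> 'k mpol \<Rightarrow> 'k mpol"
  where "act \<equiv> pol_action G \<rho> scale bs"

lemma group_G: "group G"
  using group_hom by (rule group_hom.axioms(1))

lemma act_simps [simp]: "act g (p * q) = act g p * act g q"
  "act g 0 = 0" "act g 1 = 1" "act g (const_pol c) = const_pol c"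
  by (simp_all add: pol_action_def pullback_pol_eq_eval)

lemma tot_degree_act_le: "tot_degree (act g p) \<le> tot_degree p"
  by (simp add: pol_action_def tot_degree_pullback_pol_le)

lemma act_one:
  assumes "p \<in> pol_ring (length bs)"
  shows "act \<one>\<^bsub>G\<^esub> p = p"
proof -
  interpret group G by (rule group_G)
  have "\<rho> \<one>\<^bsub>G\<^esub> v = v" for v using id_eq_one by (metis UNIV_I restrict_apply')
  then show ?thesis using assms by (simp add: pol_action_def pullback_pol_id)
qed

lemma act_mult:
  assumes g: "g \<in> carrier G" and h: "h \<in> carrier G"
  shows "act (g \<otimes>\<^bsub>G\<^esub> h) p = act g (act h p)"
proof -
  interpret group G by (rule group_G)
  have "\<rho> (inv\<^bsub>G\<^esub> (g \<otimes>\<^bsub>G\<^esub> h)) = (\<lambda>v. \<rho> (inv\<^bsub>G\<^esub> h) (\<rho> (inv\<^bsub>G\<^esub> g) v))"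
    using composition_rule[of _ "inv\<^bsub>G\<^esub> h" "inv\<^bsub>G\<^esub> g"] g h by (auto simp: inv_mult_group)
  then show ?thesis
    using pullback_pol_pullback_pol[OF linear_action, of "inv\<^bsub>G\<^esub> h"] g h by (simp add: pol_action_def)
qed

lemma act_eq_0_iff:
  assumes "g \<in> carrier G" "p \<in> pol_ring (length bs)"
  shows "act g p = 0 \<longleftrightarrow> p = 0"
proof -
  interpret group G by (rule group_G)
  \<comment> \<open>Acting by the inverse undoes the action, which is therefore injective.\<close>
  have "act (inv\<^bsub>G\<^esub> g) (act g p) = p"
    using act_mult[of "inv\<^bsub>G\<^esub> g" g p] act_one assms by simp
  then show ?thesis by auto
qed

lemma rat_action_Fract:
  assumes g: "g \<in> carrier G" and p: "p \<in> pol_ring (length bs)" and q: "q \<in> pol_ring (length bs)" "q \<noteq> 0"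
  shows "rat_action G \<rho> scale bs g (Fract p q) = Fract (act g p) (act g q)"
  unfolding rat_action_def
proof (rule the_equality)
  fix h
  assume "\<exists>p'\<in>pol_ring (length bs). \<exists>q'\<in>pol_ring (length bs). q' \<noteq> 0 \<and> Fract p q = Fract p' q' \<and>
      h = Fract (act g p') (act g q')"
  then obtain p' q' where *: "q' \<in> pol_ring (length bs)" "q' \<noteq> 0" "Fract p q = Fract p' q'"
    and h: "h = Fract (act g p') (act g q')" by blast
  then have "act g (p * q') = act g (p' * q)" using q by (simp add: eq_fract)
  then show "h = Fract (act g p) (act g q)"
    unfolding h using * g q by (simp add: eq_fract act_eq_0_iff)
qed (use assms in blast)

section \<open>Invariant fractions\<close>

text \<open>
  If \<open>p / q\<close> is reduced and invariant, \<open>q\<close> divides \<open>p * (g \<cdot> q)\<close> and hence \<open>g \<cdot> q\<close>. The action does not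
  raise the degree, so the quotient is a constant \<open>c\<close>; invariance of \<open>p / q\<close> forces the same \<open>c\<close> for \<open>p\<close>.
\<close>

lemma invariant_fraction_semi_invariant:
  assumes p: "p \<in> pol_ring (length bs)" and q: "q \<in> pol_ring (length bs)" "q \<noteq> 0" and "coprime_pol p q"
    and inv: "rat_action G \<rho> scale bs g (Fract p q) = Fract p q" and g: "g \<in> carrier G"
  shows "\<exists>c. act g p = const_pol c * p \<and> act g q = const_pol c * q"
proof -
  have gq: "act g q \<noteq> 0" using q g by (simp add: act_eq_0_iff)
  have eq: "act g p * q = p * act g q"
    using inv q gq by (simp add: rat_action_Fract[OF g p q] eq_fract)
  then have "q dvd p * act g q" by (metis dvd_triv_right)
  then have "q dvd act g q"
    using coprime_pol_dvd_mult \<open>coprime_pol p q\<close> coprime_pol_commute by blast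
  then obtain u where u: "act g q = q * u" by (elim dvdE)
  then have "tot_degree q + tot_degree u \<le> tot_degree q"
    using gq tot_degree_act_le[of g q] by (auto simp: tot_degree_mult)
  then obtain c where "u = const_pol c" using tot_degree_0_imp_const by auto
  then show ?thesis using u eq q by (intro exI[of _ c]) (auto simp: mult_ac)
qed

text \<open>
  Some two powers of \<open>g\<close> coincide, and the corresponding powers of \<open>c\<close> are the factors by which they act
  on \<open>q\<close>.
\<close>

lemma character_finite_order:
  assumes fin: "finite (carrier G)" and g: "g \<in> carrier G" and q: "q \<in> pol_ring (length bs)" "q \<noteq> 0"
    and c: "act g q = const_pol c * q"
  shows "\<exists>n>0. c ^ n = 1"
proof -
  interpret group G by (rule group_G)
  have pow: "act (g [^]\<^bsub>G\<^esub> i) q = const_pol (c ^ i) * q" for i :: nat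
  proof (induction i)
    case (Suc i)
    then show ?case
      using g act_mult[of "g [^]\<^bsub>G\<^esub> i" g q] c by (simp add: const_pol_mult mult_ac)
  qed (simp add: act_one q)
  have "c \<noteq> 0" using act_eq_0_iff[OF g q(1)] c q by auto
  have "range (\<lambda>i::nat. g [^]\<^bsub>G\<^esub> i) \<subseteq> carrier G" using g by auto
  then have "\<not> inj (\<lambda>i::nat. g [^]\<^bsub>G\<^esub> i)"
    using fin finite_subset finite_imageD infinite_UNIV_nat by blast
  then obtain i j :: nat where ij: "i < j" "g [^]\<^bsub>G\<^esub> i = g [^]\<^bsub>G\<^esub> j"
    unfolding inj_def by (metis linorder_neqE_nat)
  then have "c ^ i = c ^ j" using pow[of i] pow[of j] q by simp
  moreover have "c ^ j = c ^ i * c ^ (j - i)" using ij by (simp flip: power_add)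
  ultimately have "c ^ (j - i) = 1" using \<open>c \<noteq> 0\<close> by simp
  then show ?thesis using ij by (intro exI[of _ "j - i"]) simp
qed

text \<open>
  Numerator and denominator of a reduced invariant fraction \<open>p / q\<close> are multiplied by the same sign under
  each group element. So \<open>p\<^sup>2\<close>, \<open>p q\<close> and \<open>q\<^sup>2\<close> are invariant polynomials, and
  \<open>p / q = p\<^sup>2 / (p q) = p q / q\<^sup>2\<close> if \<open>p \<noteq> 0\<close>. The degree of \<open>p q\<close> is that of the fraction, and the square of
  the factor of smaller degree has at most this degree.
\<close>

lemma invariant_fraction_in_field_gen:
  assumes fin: "finite (carrier G)"
    and roots: "\<And>(z::'k) (n::nat). n > 0 \<Longrightarrow> z ^ n = 1 \<Longrightarrow> z = 1 \<or> z = - 1"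
    and f: "f \<in> inv_rats G \<rho> scale bs" "rat_degree (length bs) f \<le> d"
  shows "f \<in> field_gen (pol_to_rat ` {p \<in> inv_pols G \<rho> scale bs. tot_degree p \<le> d})"
    (is "f \<in> field_gen ?S")
proof -
  obtain p q where p: "p \<in> pol_ring (length bs)" and q: "q \<in> pol_ring (length bs)" "q \<noteq> 0"
    and fpq: "f = Fract p q" and cop: "coprime_pol p q"
    using reduced_fraction_exists f(1) unfolding inv_rats_def by blast
  have d: "tot_degree p + tot_degree q \<le> d"
    using f(2) rat_degree_Fract[OF p q cop] fpq by simp
  have sign: "(act g p = p \<and> act g q = q) \<or> (act g p = - p \<and> act g q = - q)" if g: "g \<in> carrier G" for g
  proof -
    obtain c where c: "act g p = const_pol c * p" "act g q = const_pol c * q"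
      using invariant_fraction_semi_invariant[OF p q cop _ g] f(1) g unfolding fpq inv_rats_def by blast
    then obtain n where "n > 0" "c ^ n = 1" using character_finite_order[OF fin g q] by blast
    then have "c = 1 \<or> c = - 1" by (rule roots)
    moreover have "const_pol (- 1) = (- 1 :: 'k mpol)"
      using const_pol_add[of "- 1" "1::'k"] by (simp add: eq_neg_iff_add_eq_0)
    ultimately show ?thesis using c by auto
  qed
  have mem: "pol_to_rat (a * b) \<in> field_gen ?S" if "a \<in> {p, q}" "b \<in> {p, q}" "tot_degree a + tot_degree b \<le> d" for a b
  proof -
    have "act g (a * b) = a * b" if "g \<in> carrier G" for g
      using sign[OF that] \<open>a \<in> {p, q}\<close> \<open>b \<in> {p, q}\<close> by auto
    then have "a * b \<in> inv_pols G \<rho> scale bs"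
      using that p q by (auto simp: inv_pols_def)
    moreover have "tot_degree (a * b) \<le> d" using tot_degree_mult_le[of a b] that by linarith
    ultimately show ?thesis using subset_field_gen[of ?S] by auto
  qed
  consider "p = 0" | "p \<noteq> 0" "tot_degree p \<le> tot_degree q" | "tot_degree q \<le> tot_degree p" by linarith
  then show ?thesis
  proof cases
    case 1
    then have "f = 0" by (simp add: fpq fract_collapse)
    then show ?thesis using is_subfield_field_gen[of ?S] by (simp add: is_subfield_def)
  next
    case 2
    then have "Fract (p * p) (p * q) \<in> field_gen ?S"
      using d q by (intro field_gen_divide mem) auto
    moreover have "f = Fract (p * p) (p * q)" using 2 q by (simp add: fpq eq_fract)
    ultimately show ?thesis by simp
  next
    case 3
    then have "Fract (p * q) (q * q) \<in> field_gen ?S"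
      using d q by (intro field_gen_divide mem) auto
    moreover have "f = Fract (p * q) (q * q)" using q by (simp add: fpq eq_fract)
    ultimately show ?thesis by simp
  qed
qed

lemma invariant_polynomial_is_invariant_fraction:
  assumes "p \<in> inv_pols G \<rho> scale bs"
  shows "pol_to_rat p \<in> inv_rats G \<rho> scale bs" "rat_degree (length bs) (pol_to_rat p) = tot_degree p"
proof -
  have p: "p \<in> pol_ring (length bs)" "\<And>g. g \<in> carrier G \<Longrightarrow> act g p = p"
    using assms by (auto simp: inv_pols_def)
  have "Fract p 1 \<in> rat_field (length bs)"
    unfolding rat_field_def using p by (intro CollectI exI[of _ p] exI[of _ 1]) auto
  then show "pol_to_rat p \<in> inv_rats G \<rho> scale bs"
    using p by (simp add: inv_rats_def pol_to_rat_def rat_action_Fract)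
  show "rat_degree (length bs) (pol_to_rat p) = tot_degree p"
    using rat_degree_Fract[of p "length bs" 1] p by (simp add: pol_to_rat_def coprime_pol_def)
qed

text \<open>
  Polynomials and rational functions of bounded degree generate the same field for every single bound.
  The two minima are therefore taken over the same set of degrees.
\<close>

lemma field_gen_invariants_of_degree:
  assumes "finite (carrier G)"
    and "\<And>(z::'k) (n::nat). n > 0 \<Longrightarrow> z ^ n = 1 \<Longrightarrow> z = 1 \<or> z = - 1"
  shows "field_gen {f \<in> inv_rats G \<rho> scale bs. rat_degree (length bs) f \<le> d} =
    field_gen (pol_to_rat ` {p \<in> inv_pols G \<rho> scale bs. tot_degree p \<le> d})"
proof (intro antisym field_gen_least subsetI)
  fix f assume "f \<in> {f \<in> inv_rats G \<rho> scale bs. rat_degree (length bs) f \<le> d}"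
  then show "f \<in> field_gen (pol_to_rat ` {p \<in> inv_pols G \<rho> scale bs. tot_degree p \<le> d})"
    by (intro invariant_fraction_in_field_gen assms) auto
next
  fix f assume "f \<in> pol_to_rat ` {p \<in> inv_pols G \<rho> scale bs. tot_degree p \<le> d}"
  then have "f \<in> {f \<in> inv_rats G \<rho> scale bs. rat_degree (length bs) f \<le> d}"
    using invariant_polynomial_is_invariant_fraction by auto
  then show "f \<in> field_gen {f \<in> inv_rats G \<rho> scale bs. rat_degree (length bs) f \<le> d}"
    by (rule subsetD[OF subset_field_gen])
qed

end

theorem proposition3p1:
  fixes G :: "('g, 'm) monoid_scheme"
    and \<rho> :: "'g \<Rightarrow> 'v::ab_group_add \<Rightarrow> 'v"
    and scale :: "'k::field \<Rightarrow> 'v \<Rightarrow> 'v"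
    and bs :: "'v list"
  assumes "fd_representation G \<rho> scale bs"
    and "finite (carrier G)"
    and "\<And>(z::'k) (n::nat). n > 0 \<Longrightarrow> z ^ n = 1 \<Longrightarrow> z = 1 \<or> z = - 1"
  shows "beta_field_rat G \<rho> scale bs = beta_field G \<rho> scale bs"
  using fd_representation.field_gen_invariants_of_degree[OF assms]
  by (simp add: beta_field_rat_def beta_field_def)

end
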